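(* Let $X$ and $Y$ be measurable spaces and let $\nu$ be a kernel from $X$ to $Y$. Then: 1. for any measurable function $f:X\times Y\to[0,\infty)$, $\nu\triangleright f$ is a $\sigma$-finite kernel if $\nu$ is a $\sigma$-finite kernel; in particular, $\nu\triangleright f$ is $\sigma$-finite if $\nu$ is a subprobability kernel; 2. conversely, if $\nu$ is a $\sigma$-finite kernel, then there exist a subprobability kernel $\mu$ from $X$ to $Y$ and a measurable function $f:X\times Y\to(0,\infty)$ such that $\nu=\mu\triangleright f$; 3. $\nu$ is $\sigma$-finite if and only if there exists a measurable function $g:X\times Y\to(0,\infty)$ such that $\nu\triangleright g$ is a subprobability kernel (equivalently, such that $\nu\triangleright g$ is a finite kernel).
   Context: A kernel from a measurable space $X$ to a measurable space $Y$ is a map $k:X\times\Sigma_Y\to[0,\infty]$ that is measurable in its first argument and a measure in its second. It is a subprobability kernel if $\sup_{x}k(x,Y)\le 1$; finite if $\sup_{x\in X}k(x,Y)<\infty$; $\sigma$-finite if $k=\sum_{i\in\mathbb{N}}k_i$ with the $k_i$ finite kernels from $X$ to $Y$ that are pairwise mutually singular. For $C\in\Sigma_{X\times Y}$ write $C^x=\{y\mid (x,y)\in C\}$; $k$ is supported in $C$ if $k(x,Y\setminus C^x)=0$ for all $x$. Kernels $k,l$ from $X$ to $Y$ are mutually singular if there is $A\in\Sigma_{X\times Y}$ such that $k$ is supported in $A$ and $l$ is supported in $(X\times Y)\setminus A$. For a kernel $k$ from $X$ to $Y$ and measurable $f:X\times Y\to[0,\infty]$, $(k\triangleright f)(x,V):=\int_V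 k(x,\mathrm{d}y)\,f(x,y)$. Convention: $\infty\cdot 0=0$. *)

theory Defs
  imports "HOL-Analysis.Analysis"
begin

text \<open>
  Measurable spaces are given by the carrier and sigma-algebra of a value of type
  \<^typ>\<open>'a measure\<close>; the measure it carries is irrelevant. A kernel from \<open>X\<close> to \<open>Y\<close> is
  a map \<open>x \<mapsto> k x\<close> into measures on \<open>Y\<close>, with \<open>k x\<close> unconstrained outside \<open>space X\<close>,
  so that equality of kernels means equality at all points of \<open>space X\<close>.
\<close>

definition measure_kernel :: "'a measure \<Rightarrow> 'b measure \<Rightarrow> ('a \<Rightarrow> 'b measure) \<Rightarrow> bool" where
  "measure_kernel X Y k \<longleftrightarrow>
     (\<forall>x\<in>space X. sets (k x) = sets Y) \<and>
     (\<forall>B\<in>sets Y. (\<lambda>x. emeasure (k x) B) \<in> borel_measurable X)"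

text \<open>
  The library predicate \<^const>\<open>finite_measure\<close> would only give finiteness pointwise in
  \<open>x\<close>; the bounds below are uniform. The supremum is taken in \<^typ>\<open>ennreal\<close>, hence is
  \<open>0\<close> when \<open>space X\<close> is empty.
\<close>

definition subprob_kernel :: "'a measure \<Rightarrow> 'b measure \<Rightarrow> ('a \<Rightarrow> 'b measure) \<Rightarrow> bool" where
  "subprob_kernel X Y k \<longleftrightarrow>
     measure_kernel X Y k \<and> (SUP x\<in>space X. emeasure (k x) (space Y)) \<le> 1"

definition finite_kernel :: "'a measure \<Rightarrow> 'b measure \<Rightarrow> ('a \<Rightarrow> 'b measure) \<Rightarrow> bool" where
  "finite_kernel X Y k \<longleftrightarrow>
     measure_kernel X Y k \<and> (SUP x\<in>space X. emeasure (k x) (space Y)) < \<infinity>"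

definition supported_in ::
  "'a measure \<Rightarrow> 'b measure \<Rightarrow> ('a \<Rightarrow> 'b measure) \<Rightarrow> ('a \<times> 'b) set \<Rightarrow> bool" where
  "supported_in X Y k C \<longleftrightarrow>
     C \<in> sets (X \<Otimes>\<^sub>M Y) \<and>
     (\<forall>x\<in>space X. emeasure (k x) (space Y - {y. (x, y) \<in> C}) = 0)"

definition mutually_singular_kernels ::
  "'a measure \<Rightarrow> 'b measure \<Rightarrow> ('a \<Rightarrow> 'b measure) \<Rightarrow> ('a \<Rightarrow> 'b measure) \<Rightarrow> bool" where
  "mutually_singular_kernels X Y k l \<longleftrightarrow>
     (\<exists>A\<in>sets (X \<Otimes>\<^sub>M Y). supported_in X Y k A \<and> supported_in X Y l (space X \<times> space Y - A))"

definition sigma_finite_kernel :: "'a measure \<Rightarrow> 'b measure \<Rightarrow> ('a \<Rightarrow> 'b measure) \<Rightarrow> bool" where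
  "sigma_finite_kernel X Y k \<longleftrightarrow>
     measure_kernel X Y k \<and>
     (\<exists>ks :: nat \<Rightarrow> 'a \<Rightarrow> 'b measure.
        (\<forall>i. finite_kernel X Y (ks i)) \<and>
        (\<forall>i j. i \<noteq> j \<longrightarrow> mutually_singular_kernels X Y (ks i) (ks j)) \<and>
        (\<forall>x\<in>space X. \<forall>B\<in>sets Y. emeasure (k x) B = (\<Sum>i. emeasure (ks i x) B)))"

text \<open>
  For \<open>k\<close> a kernel from \<open>X\<close> to \<open>Y\<close>, \<open>f\<close> measurable, \<open>x \<in> space X\<close> and \<open>V \<in> sets Y\<close>,
  \<open>emeasure (kernel_density k f x) V\<close> is the integral of \<open>f (x, y)\<close> over \<open>y \<in> V\<close> with
  respect to \<open>k x\<close>, by \<open>emeasure_density\<close>.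
\<close>

definition kernel_density ::
  "('a \<Rightarrow> 'b measure) \<Rightarrow> ('a \<times> 'b \<Rightarrow> ennreal) \<Rightarrow> 'a \<Rightarrow> 'b measure" (infixl "\<triangleright>" 70) where
  "(k \<triangleright> f) = (\<lambda>x. density (k x) (\<lambda>y. f (x, y)))"

end

theory Submission
  imports Defs
begin

text \<open>
  Mutual singularity makes the summands of a \<open>\<sigma>\<close>-finite kernel live on disjoint measurable sets
  \<open>A i\<close>, so a single strictly positive function \<open>g\<close> that is a small constant on each \<open>A i\<close> turns
  \<open>\<nu>\<close> into a subprobability kernel \<open>\<nu> \<triangleright> g\<close>. Conversely, a finite kernel with a finite density \<open>h\<close> is cut
  into finite pieces along the level sets \<open>i \<le> h < i + 1\<close>, and \<open>\<nu> \<triangleright> f = (\<nu> \<triangleright> g) \<triangleright> (f / g)\<close> reduces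
  every claim to these two constructions.
\<close>

section \<open>Elementary facts on kernels and densities\<close>

lemma measure_kernel_sets: "measure_kernel X Y k \<Longrightarrow> x \<in> space X \<Longrightarrow> sets (k x) = sets Y"
  by (simp add: measure_kernel_def)

lemma measure_kernel_space: "measure_kernel X Y k \<Longrightarrow> x \<in> space X \<Longrightarrow> space (k x) = space Y"
  by (metis measure_kernel_sets sets_eq_imp_space_eq)

lemma measure_kernel_section_measurable:
  assumes "measure_kernel X Y k" "x \<in> space X" "f \<in> borel_measurable (X \<Otimes>\<^sub>M Y)"
  shows "(\<lambda>y. f (x, y)) \<in> borel_measurable (k x)"
  using measurable_Pair2[OF assms(3,2)] measurable_cong_sets[OF measure_kernel_sets[OF assms(1,2)] refl]
  by blast

lemma emeasure_kernel_density:
  assumes "measure_kernel X Y k" "x \<in> space X" "f \<in> borel_measurable (X \<Otimes>\<^sub>M Y)" "B \<in> sets Y"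
  shows "emeasure ((k \<triangleright> f) x) B = (\<integral>\<^sup>+ y. f (x, y) * indicator B y \<partial>k x)"
  unfolding kernel_density_def
  by (rule emeasure_density)
     (use assms measure_kernel_section_measurable[OF assms(1-3)] measure_kernel_sets[OF assms(1,2)] in auto)

text \<open>Successive densities multiply, and \<open>g * (f / g) = f\<close> holds pointwise
  because \<open>g\<close> avoids \<open>0\<close> and \<open>\<infinity>\<close>, the two values
  that do not cancel in \<open>ennreal\<close>. This identity allows a change of base kernel from
  \<open>k\<close> to \<open>k \<triangleright> g\<close>.\<close>

lemma kernel_density_kernel_density:
  assumes k: "measure_kernel X Y k" and x: "x \<in> space X"
    and f: "f \<in> borel_measurable (X \<Otimes>\<^sub>M Y)"
    and g: "g \<in> borel_measurable (X \<Otimes>\<^sub>M Y)" "\<And>z. z \<in> space (X \<Otimes>\<^sub>M Y) \<Longrightarrow> 0 < g z \<and> g z < \<infinity>"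
  shows "((k \<triangleright> g) \<triangleright> (\<lambda>z. f z / g z)) x = (k \<triangleright> f) x"
proof -
  have meas: "(\<lambda>y. g (x, y)) \<in> borel_measurable (k x)" "(\<lambda>y. f (x, y)) \<in> borel_measurable (k x)"
    using measure_kernel_section_measurable[OF k x] f g(1) by auto
  have "g (x, y) * (f (x, y) / g (x, y)) = f (x, y)" if "y \<in> space (k x)" for y
    using g(2)[of "(x, y)"] that x measure_kernel_space[OF k x]
    by (auto simp: space_pair_measure ennreal_times_divide mult.commute[of "g (x, y)"] mult_divide_eq_ennreal)
  then show ?thesis
    unfolding kernel_density_def using meas
    by (subst density_density_eq) (auto intro!: density_cong)
qed

lemma kernel_density_one: "k \<triangleright> (\<lambda>_. 1) = k"
  by (simp add: kernel_density_def density_1)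

text \<open>Values of a kernel outside \<open>space X\<close> are arbitrary, so identities between
  kernels are available on \<open>space X\<close> only; this carries \<sigma>-finiteness across
  them.\<close>

lemma sigma_finite_kernel_cong:
  assumes "\<And>x. x \<in> space X \<Longrightarrow> k x = l x"
  shows "sigma_finite_kernel X Y k \<longleftrightarrow> sigma_finite_kernel X Y l"
proof -
  have "measure_kernel X Y k \<longleftrightarrow> measure_kernel X Y l"
    unfolding measure_kernel_def using assms
    by (intro arg_cong2[of _ _ _ _ "(\<and>)"] ball_cong refl measurable_cong) auto
  then show ?thesis
    unfolding sigma_finite_kernel_def using assms by simp
qed

lemma subprob_kernel_imp_finite_kernel: "subprob_kernel X Y k \<Longrightarrow> finite_kernel X Y k"
  unfolding subprob_kernel_def finite_kernel_def
  by (metis ennreal_one_less_top infinity_ennreal_def order_le_less_trans)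

lemma finite_kernel_imp_finite:
  assumes "finite_kernel X Y k" "x \<in> space X"
  shows "emeasure (k x) (space Y) < \<infinity>"
  using assms SUP_upper[OF assms(2), of "\<lambda>x. emeasure (k x) (space Y)"]
  unfolding finite_kernel_def by (metis order_le_less_trans)

section \<open>Supports of mutually singular kernels\<close>

text \<open>Sections of a measurable set are measurable, so the null set in the definition is
  exactly an almost-everywhere exception set. In this form countably many supports can be
  intersected directly.\<close>

lemma supported_in_iff_AE:
  assumes "measure_kernel X Y k"
  shows "supported_in X Y k C \<longleftrightarrow>
    C \<in> sets (X \<Otimes>\<^sub>M Y) \<and> (\<forall>x\<in>space X. AE y in k x. (x, y) \<in> C)"
proof -
  have "emeasure (k x) (space Y - {y. (x, y) \<in> C}) = 0 \<longleftrightarrow> (AE y in k x. (x, y) \<in> C)"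
    if "C \<in> sets (X \<Otimes>\<^sub>M Y)" "x \<in> space X" for x
  proof (subst AE_iff_measurable)
    have eq: "{y. (x, y) \<in> C} = Pair x -` C" by auto
    show "space Y - {y. (x, y) \<in> C} \<in> sets (k x)"
      unfolding eq measure_kernel_sets[OF assms that(2)]
      using sets_Pair1[OF that(1)] by auto
    show "{y \<in> space (k x). (x, y) \<notin> C} = space Y - {y. (x, y) \<in> C}"
      using measure_kernel_space[OF assms that(2)] by auto
  qed simp
  then show ?thesis
    unfolding supported_in_def by auto
qed

text \<open>Each pair of distinct indices yields a separating set, and countably many almost-sure
  conditions can be imposed at once. Intersecting all those that concern \<open>i\<close> gives one
  support per kernel, and these supports are disjoint.\<close>

lemma disjoint_supports:
  fixes ks :: "nat \<Rightarrow> 'a \<Rightarrow> 'b measure"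
  assumes k: "\<And>i. measure_kernel X Y (ks i)"
    and sing: "\<And>i j. i \<noteq> j \<Longrightarrow> mutually_singular_kernels X Y (ks i) (ks j)"
  obtains A where "disjoint_family A" "\<And>i. supported_in X Y (ks i) (A i)"
proof -
  obtain S where S: "\<And>i j. i \<noteq> j \<Longrightarrow> S i j \<in> sets (X \<Otimes>\<^sub>M Y) \<and> supported_in X Y (ks i) (S i j)
      \<and> supported_in X Y (ks j) (space X \<times> space Y - S i j)"
    using sing unfolding mutually_singular_kernels_def by metis
  \<comment> \<open>\<open>S i j\<close> and \<open>S j i\<close> are chosen independently, so
    \<open>A i\<close> uses both: it lies in \<open>S i j\<close> and avoids \<open>S j i\<close>.
    For \<open>i \<noteq> j\<close>, \<open>A i\<close> is then inside \<open>S i j\<close> and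
    \<open>A j\<close> outside it, which gives disjointness.\<close>
  define A where
    "A i = (space X \<times> space Y) \<inter> (\<Inter>j\<in>-{i}. S i j \<inter> (space X \<times> space Y - S j i))" for i
  show thesis
  proof
    show "disjoint_family A"
      unfolding disjoint_family_on_def A_def by auto
    fix i
    have S_sets: "S i j \<inter> (space X \<times> space Y - S j i) \<in> sets (X \<Otimes>\<^sub>M Y)" if "j \<noteq> i" for j
      using S[of i j] S[of j i] that unfolding supported_in_def by blast
    \<comment> \<open>The countable intersection is written as the complement of a countable union,
      the form in which measurability is derived.\<close>
    have "A i = space (X \<Otimes>\<^sub>M Y) - (\<Union>j\<in>-{i}. space (X \<Otimes>\<^sub>M Y) - S i j \<inter> (space X \<times> space Y - S j i))"
      unfolding A_def space_pair_measure by auto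
    also have "\<dots> \<in> sets (X \<Otimes>\<^sub>M Y)"
      using S_sets by (intro sets.Diff sets.top sets.countable_UN') auto
    finally have "A i \<in> sets (X \<Otimes>\<^sub>M Y)" .
    moreover have "AE y in ks i x. (x, y) \<in> A i" if x: "x \<in> space X" for x
    proof -
      have "AE y in ks i x. \<forall>j\<in>-{i}. (x, y) \<in> S i j \<inter> (space X \<times> space Y - S j i)"
      proof (subst AE_ball_countable)
        show "\<forall>j\<in>-{i}. AE y in ks i x. (x, y) \<in> S i j \<inter> (space X \<times> space Y - S j i)"
        proof
          fix j assume "j \<in> -{i}"
          then have "AE y in ks i x. (x, y) \<in> S i j"
            "AE y in ks i x. (x, y) \<in> space X \<times> space Y - S j i"
            using S[of i j] S[of j i] x by (auto simp: supported_in_iff_AE[OF k])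
          then show "AE y in ks i x. (x, y) \<in> S i j \<inter> (space X \<times> space Y - S j i)"
            by eventually_elim auto
        qed
      qed auto
      with AE_space show ?thesis
        unfolding A_def
        by eventually_elim (use x measure_kernel_space[OF k x] in auto)
    qed
    ultimately show "supported_in X Y (ks i) (A i)"
      by (simp add: supported_in_iff_AE[OF k])
  qed
qed

text \<open>Since \<open>ks j\<close> lives on \<open>A j\<close> and the \<open>A i\<close> are
  disjoint, only the summand \<open>ks i\<close> charges the section of \<open>A i\<close>, and none
  charges the complement of the union. Hence \<nu> restricted to \<open>A i\<close> is
  \<open>ks i\<close>.\<close>

lemma emeasure_sum_on_support:
  fixes ks :: "nat \<Rightarrow> 'a \<Rightarrow> 'b measure"
  assumes k: "\<And>i. measure_kernel X Y (ks i)"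
    and sum: "\<And>B. B \<in> sets Y \<Longrightarrow> emeasure (\<nu> x) B = (\<Sum>i. emeasure (ks i x) B)"
    and A: "disjoint_family A" "\<And>i. supported_in X Y (ks i) (A i)"
    and x: "x \<in> space X" and B: "B \<in> sets Y"
  shows "emeasure (\<nu> x) (Pair x -` A i \<inter> B) = emeasure (ks i x) B"
    and "emeasure (\<nu> x) (B - Pair x -` (\<Union>i. A i)) = 0"
proof -
  have sets_A: "A i \<in> sets (X \<Otimes>\<^sub>M Y)" for i
    using A(2) unfolding supported_in_def by blast
  have sec: "Pair x -` A i \<inter> B \<in> sets Y" for i
    using sets_Pair1[OF sets_A] B by auto
  have sec': "B - Pair x -` (\<Union>i. A i) \<in> sets Y"
    using B sets_Pair1[OF sets.countable_UN[of A UNIV]] sets_A by auto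
  have AE: "AE y in ks j x. (x, y) \<in> A j" for j
    using A(2)[of j] x by (simp add: supported_in_iff_AE[OF k])
  have "emeasure (ks j x) (Pair x -` A i \<inter> B) = (if j = i then emeasure (ks i x) B else 0)" for j
  proof -
    \<comment> \<open>Almost every point for \<open>ks j x\<close> lies in the section of
      \<open>A j\<close>, hence in that of \<open>A i\<close> exactly when \<open>j = i\<close>; the
      set therefore agrees almost everywhere with \<open>B\<close> or with the empty set.\<close>
    have "emeasure (ks j x) (Pair x -` A i \<inter> B) = emeasure (ks j x) (if j = i then B else {})"
      by (rule emeasure_eq_AE)
         (use AE[of j] in eventually_elim, use A(1) sec[of i] B measure_kernel_sets[OF k x] in
           \<open>auto simp: disjoint_family_on_def\<close>)
    then show ?thesis by simp
  qed
  then show "emeasure (\<nu> x) (Pair x -` A i \<inter> B) = emeasure (ks i x) B"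
    unfolding sum[OF sec] using sums_unique[OF sums_single[of i "\<lambda>_. emeasure (ks i x) B"]] by simp
  have "emeasure (ks j x) (B - Pair x -` (\<Union>i. A i)) = emeasure (ks j x) {}" for j
    by (rule emeasure_eq_AE)
       (use AE[of j] in eventually_elim, use sec' measure_kernel_sets[OF k x] in auto)
  then show "emeasure (\<nu> x) (B - Pair x -` (\<Union>i. A i)) = 0"
    unfolding sum[OF sec'] by simp
qed

section \<open>A strictly positive density that yields a subprobability kernel\<close>

text \<open>With \<open>g\<close> equal to \<open>d i\<close> on \<open>A i\<close>, the kernel
  \<open>\<nu> \<triangleright> g\<close> becomes the weighted series of the \<open>ks i\<close>.
  The weights are chosen so that the \<open>i\<close>-th term has mass at most
  \<open>(1/2) ^ Suc i\<close>, uniformly in \<open>x\<close>.\<close>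

lemma sigma_finite_kernel_imp_subprob_density:
  assumes "sigma_finite_kernel X Y \<nu>"
  obtains g where "g \<in> borel_measurable (X \<Otimes>\<^sub>M Y)"
    "\<And>z. z \<in> space (X \<Otimes>\<^sub>M Y) \<Longrightarrow> 0 < g z \<and> g z < \<infinity>" "subprob_kernel X Y (\<nu> \<triangleright> g)"
proof -
  obtain ks :: "nat \<Rightarrow> 'a \<Rightarrow> 'b measure" where
    fin: "\<And>i. finite_kernel X Y (ks i)" and
    sing: "\<And>i j. i \<noteq> j \<Longrightarrow> mutually_singular_kernels X Y (ks i) (ks j)" and
    sum: "\<And>x B. x \<in> space X \<Longrightarrow> B \<in> sets Y \<Longrightarrow> emeasure (\<nu> x) B = (\<Sum>i. emeasure (ks i x) B)"
    using assms unfolding sigma_finite_kernel_def by blast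
  have \<nu>: "measure_kernel X Y \<nu>"
    using assms unfolding sigma_finite_kernel_def by blast
  have k: "measure_kernel X Y (ks i)" for i
    using fin unfolding finite_kernel_def by blast
  obtain A where A: "disjoint_family A" "\<And>i. supported_in X Y (ks i) (A i)"
    by (rule disjoint_supports[of X Y ks]) (use k sing in blast)+
  have [measurable]: "A i \<in> sets (X \<Otimes>\<^sub>M Y)" for i
    using A(2) unfolding supported_in_def by blast
  define c where "c i = (SUP x\<in>space X. emeasure (ks i x) (space Y))" for i
  have c: "c i < \<infinity>" for i
    using fin unfolding finite_kernel_def c_def by blast
  have le_c: "emeasure (ks i x) (space Y) \<le> c i" if "x \<in> space X" for i x
    unfolding c_def using that by (rule SUP_upper)
  \<comment> \<open>The powers of \<open>1/2\<close> sum to \<open>1\<close>. The summand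
    \<open>1\<close> in the denominator keeps \<open>d i\<close> finite even if
    \<open>c i = 0\<close>; finiteness of \<open>c i\<close> keeps \<open>d i\<close>
    positive.\<close>
  define d where "d i = ennreal ((1/2) ^ Suc i) / (1 + c i)" for i
  have d: "0 < d i" "d i < \<infinity>" for i
    using c[of i] by (auto simp: d_def ennreal_zero_less_divide less_top[symmetric] ennreal_divide_eq_top_iff)
  \<comment> \<open>The supports need not cover the product, yet \<open>g\<close> must be positive
    everywhere. Its value \<open>1\<close> on \<open>N\<close> costs nothing, since the sections of
    \<open>N\<close> are null for \<nu>.\<close>
  define N where "N = space (X \<Otimes>\<^sub>M Y) - (\<Union>i. A i)"
  have [measurable]: "N \<in> sets (X \<Otimes>\<^sub>M Y)"
    unfolding N_def by measurable
  define g where "g z = (\<Sum>i. d i * indicator (A i) z) + indicator N z" for z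
  have g_A: "g z = d i" if "z \<in> A i" for z i
  proof -
    have "z \<notin> N" using that by (auto simp: N_def)
    then show ?thesis
      using suminf_cmult_indicator[OF A(1) that, of d] by (simp add: g_def)
  qed
  have g_N: "g z = 1" if "z \<in> N" for z
    using that by (simp add: g_def N_def)
  have g_meas[measurable]: "g \<in> borel_measurable (X \<Otimes>\<^sub>M Y)"
    unfolding g_def by measurable
  have g_pos: "0 < g z \<and> g z < \<infinity>" if "z \<in> space (X \<Otimes>\<^sub>M Y)" for z
    using that g_A[of z] g_N[of z] d by (cases "z \<in> N") (auto simp: N_def)
  have density: "emeasure ((\<nu> \<triangleright> g) x) B = (\<Sum>i. d i * emeasure (ks i x) B)"
    if x: "x \<in> space X" and B: "B \<in> sets Y" for x B
  proof -
    have sets_k: "sets (\<nu> x) = sets Y" by (rule measure_kernel_sets[OF \<nu> x])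
    have sec: "Pair x -` A i \<inter> B \<in> sets (\<nu> x)" for i
      unfolding sets_k using sets_Pair1[of "A i" X Y x] B by auto
    have "Pair x -` (\<Union>i. A i) \<in> sets Y"
      by (rule sets_Pair1[of _ X]) measurable
    then have sec': "B - Pair x -` (\<Union>i. A i) \<in> sets (\<nu> x)"
      unfolding sets_k using B by blast
    have "emeasure ((\<nu> \<triangleright> g) x) B = (\<integral>\<^sup>+ y. g (x, y) * indicator B y \<partial>\<nu> x)"
      by (rule emeasure_kernel_density[OF \<nu> x g_meas B])
    also have "\<dots> = (\<integral>\<^sup>+ y. (\<Sum>i. d i * indicator (Pair x -` A i \<inter> B) y)
        + indicator (B - Pair x -` (\<Union>i. A i)) y \<partial>\<nu> x)"
    proof (rule nn_integral_cong)
      fix y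
      have "y \<in> B \<Longrightarrow> (x, y) \<in> N \<longleftrightarrow> y \<in> B - Pair x -` (\<Union>i. A i)"
        using x sets.sets_into_space[OF B] by (auto simp: N_def space_pair_measure)
      then show "g (x, y) * indicator B y = (\<Sum>i. d i * indicator (Pair x -` A i \<inter> B) y)
          + indicator (B - Pair x -` (\<Union>i. A i)) y"
        by (cases "y \<in> B") (simp_all add: g_def indicator_def)
    qed
    also have "\<dots> = (\<Sum>i. d i * emeasure (\<nu> x) (Pair x -` A i \<inter> B))
        + emeasure (\<nu> x) (B - Pair x -` (\<Union>i. A i))"
      using sec sec'
      by (subst nn_integral_add) (auto simp: nn_integral_suminf nn_integral_cmult_indicator)
    also have "\<dots> = (\<Sum>i. d i * emeasure (ks i x) B)"
      using emeasure_sum_on_support[of X Y ks \<nu> x A B, OF k sum[OF x] A x B] by simp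
    finally show ?thesis .
  qed
  \<comment> \<open>For an arbitrary kernel, measurability of an integral in \<open>x\<close> is not
    automatic; here it is read off the series \<open>density\<close>, whose terms are
    measurable.\<close>
  have "measure_kernel X Y (\<nu> \<triangleright> g)"
    unfolding measure_kernel_def
  proof (intro conjI ballI)
    show "sets ((\<nu> \<triangleright> g) x) = sets Y" if "x \<in> space X" for x
      using measure_kernel_sets[OF \<nu> that] by (simp add: kernel_density_def)
    fix B assume B: "B \<in> sets Y"
    then have [measurable]: "(\<lambda>x. emeasure (ks i x) B) \<in> borel_measurable X" for i
      using k unfolding measure_kernel_def by blast
    show "(\<lambda>x. emeasure ((\<nu> \<triangleright> g) x) B) \<in> borel_measurable X"
      by (subst measurable_cong[OF density[OF _ B]]) auto
  qed
  moreover have "emeasure ((\<nu> \<triangleright> g) x) (space Y) \<le> 1" if x: "x \<in> space X" for x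
  proof -
    have "d i * emeasure (ks i x) (space Y) \<le> ennreal ((1/2) ^ Suc i)" for i
    proof -
      have "d i * emeasure (ks i x) (space Y) \<le> d i * (1 + c i)"
        using le_c[OF x, of i] by (intro mult_left_mono) (auto intro: add_increasing)
      also have "\<dots> = ennreal ((1/2) ^ Suc i)"
        using c[of i] unfolding d_def
        by (subst ennreal_divide_times) (simp add: less_top)
      finally show ?thesis .
    qed
    then have "emeasure ((\<nu> \<triangleright> g) x) (space Y) \<le> (\<Sum>i. ennreal ((1/2) ^ Suc i))"
      unfolding density[OF x sets.top] by (intro suminf_le) auto
    also have "\<dots> = 1"
      by (subst suminf_ennreal_eq[OF _ power_half_series]) auto
    finally show ?thesis .
  qed
  ultimately have "subprob_kernel X Y (\<nu> \<triangleright> g)"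
    unfolding subprob_kernel_def by (auto intro: SUP_least)
  with that g_meas g_pos show thesis by blast
qed

section \<open>Measurability of integrals against finite kernels\<close>

text \<open>A Dynkin-system argument: rectangles are an intersection-stable generator, complements
  become differences of measures, and disjoint unions become series.\<close>

lemma finite_kernel_section_emeasure_measurable:
  assumes fin: "finite_kernel X Y k" and "C \<in> sets (X \<Otimes>\<^sub>M Y)"
  shows "(\<lambda>x. emeasure (k x) (Pair x -` C)) \<in> borel_measurable X"
proof -
  have k: "measure_kernel X Y k"
    using fin unfolding finite_kernel_def by blast
  have k_meas[measurable]: "(\<lambda>x. emeasure (k x) B) \<in> borel_measurable X" if "B \<in> sets Y" for B
    using k that unfolding measure_kernel_def by blast
  show ?thesis
    using Int_stable_pair_measure_generator pair_measure_closed assms(2)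
    unfolding sets_pair_measure
  proof (induct rule: sigma_sets_induct_disjoint)
    case (basic C)
    then obtain A B where C: "C = A \<times> B" and [measurable]: "A \<in> sets X" "B \<in> sets Y" by auto
    have "emeasure (k x) (Pair x -` C) = emeasure (k x) B * indicator A x" for x
      by (auto simp: C indicator_def)
    then show ?case by simp
  next
    case empty
    then show ?case by simp
  next
    case (compl C)
    then have C: "C \<in> sets (X \<Otimes>\<^sub>M Y)" unfolding sets_pair_measure by simp
    \<comment> \<open>Finiteness of the kernel enters here: the measure of a complement is a
      difference only when the subtracted mass is finite.\<close>
    have eq: "emeasure (k x) (Pair x -` (space X \<times> space Y - C)) =
        emeasure (k x) (space Y) - emeasure (k x) (Pair x -` C)" if x: "x \<in> space X" for x
    proof -
      have sec: "Pair x -` C \<in> sets (k x)"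
        unfolding measure_kernel_sets[OF k x] by (rule sets_Pair1[OF C])
      have "emeasure (k x) (Pair x -` C) \<le> emeasure (k x) (space (k x))"
        by (rule emeasure_space)
      then have "emeasure (k x) (Pair x -` C) \<noteq> \<infinity>"
        using finite_kernel_imp_finite[OF fin x] measure_kernel_space[OF k x] by auto
      with emeasure_compl[OF sec] show ?thesis
        using x measure_kernel_space[OF k x] by (simp add: vimage_Diff)
    qed
    show ?case
      using compl(2) by (subst measurable_cong[OF eq]) auto
  next
    case (union F)
    then have F: "F i \<in> sets (X \<Otimes>\<^sub>M Y)" for i unfolding sets_pair_measure by auto
    have eq: "emeasure (k x) (Pair x -` (\<Union>i. F i)) = (\<Sum>i. emeasure (k x) (Pair x -` F i))"
      if x: "x \<in> space X" for x
    proof -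
      have "Pair x -` F i \<in> sets (k x)" for i
        unfolding measure_kernel_sets[OF k x] by (rule sets_Pair1[OF F])
      then show ?thesis
        using union(1) by (simp add: suminf_emeasure disjoint_family_on_vimageI image_subset_iff vimage_UN)
    qed
    show ?case
      using union(3) by (subst measurable_cong[OF eq]) auto
  qed
qed

text \<open>Induction on \<open>f\<close>: indicators are the preceding lemma, linearity treats
  multiples and sums, and monotone convergence treats suprema.\<close>

lemma finite_kernel_nn_integral_measurable:
  assumes fin: "finite_kernel X Y k" and "f \<in> borel_measurable (X \<Otimes>\<^sub>M Y)"
  shows "(\<lambda>x. \<integral>\<^sup>+ y. f (x, y) \<partial>k x) \<in> borel_measurable X"
proof -
  have k: "measure_kernel X Y k"
    using fin unfolding finite_kernel_def by blast
  note sec = measure_kernel_section_measurable[OF k]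
  show ?thesis
    using assms(2)
  proof induct
    case (cong f g)
    then have eq: "(\<integral>\<^sup>+ y. f (x, y) \<partial>k x) = (\<integral>\<^sup>+ y. g (x, y) \<partial>k x)" if "x \<in> space X" for x
      using that measure_kernel_space[OF k that]
      by (intro nn_integral_cong) (auto simp: space_pair_measure)
    show ?case
      using cong(4) by (simp only: measurable_cong[OF eq])
  next
    case (set C)
    have eq: "(\<integral>\<^sup>+ y. indicator C (x, y) \<partial>k x) = emeasure (k x) (Pair x -` C)" if "x \<in> space X" for x
    proof -
      have "Pair x -` C \<in> sets (k x)"
        unfolding measure_kernel_sets[OF k that] by (rule sets_Pair1[OF set])
      moreover have "(\<integral>\<^sup>+ y. indicator C (x, y) \<partial>k x) = (\<integral>\<^sup>+ y. indicator (Pair x -` C) y \<partial>k x)"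
        by (rule nn_integral_cong) (simp add: indicator_def)
      ultimately show ?thesis by simp
    qed
    show ?case
      using finite_kernel_section_emeasure_measurable[OF fin set] by (simp only: measurable_cong[OF eq])
  next
    case (mult u c)
    then show ?case
      by (subst measurable_cong[OF nn_integral_cmult[OF sec]]) auto
  next
    case (add u v)
    then show ?case
      by (subst measurable_cong[OF nn_integral_add[OF sec sec]]) auto
  next
    case (seq U)
    have eq: "(\<integral>\<^sup>+ y. (SUP i. U i) (x, y) \<partial>k x) = (SUP i. \<integral>\<^sup>+ y. U i (x, y) \<partial>k x)"
      if "x \<in> space X" for x
      using seq(4) sec[OF that seq(1)]
      by (simp add: image_comp nn_integral_monotone_convergence_SUP incseq_def le_fun_def)
    show ?case
      using seq(3) by (subst measurable_cong[OF eq]) auto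
  qed
qed

lemma measure_kernel_kernel_density:
  assumes fin: "finite_kernel X Y k" and f[measurable]: "f \<in> borel_measurable (X \<Otimes>\<^sub>M Y)"
  shows "measure_kernel X Y (k \<triangleright> f)"
  unfolding measure_kernel_def
proof (intro conjI ballI)
  have k: "measure_kernel X Y k"
    using fin unfolding finite_kernel_def by blast
  show "sets ((k \<triangleright> f) x) = sets Y" if "x \<in> space X" for x
    using measure_kernel_sets[OF k that] by (simp add: kernel_density_def)
  fix B assume B[measurable]: "B \<in> sets Y"
  \<comment> \<open>Composing with \<open>snd\<close> makes the restriction to \<open>B\<close> part
    of an integrand on the product, as the preceding lemma requires.\<close>
  have "(\<lambda>x. \<integral>\<^sup>+ y. f (x, y) * indicator B (snd (x, y)) \<partial>k x) \<in> borel_measurable X"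
    by (rule finite_kernel_nn_integral_measurable[OF fin, of "\<lambda>z. f z * indicator B (snd z)"]) measurable
  then show "(\<lambda>x. emeasure ((k \<triangleright> f) x) B) \<in> borel_measurable X"
    by (subst measurable_cong[OF emeasure_kernel_density[OF k _ f B]]) simp_all
qed

section \<open>Slicing a density along its level sets\<close>

lemma ex_nat_level:
  fixes r :: ennreal
  assumes "r < \<infinity>"
  obtains n :: nat where "of_nat n \<le> r" "r < of_nat (Suc n)"
proof -
  define m where "m = (LEAST m. r < of_nat m)"
  have m: "r < of_nat m"
    unfolding m_def using ennreal_Ex_less_of_nat[of r] assms by (auto intro: LeastI_ex)
  \<comment> \<open>The least \<open>m\<close> above \<open>r\<close> is not \<open>0\<close>, as
    nothing in \<open>ennreal\<close> is below \<open>0\<close>; its predecessor is the integer part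
    of \<open>r\<close>.\<close>
  then obtain n where n: "m = Suc n"
    by (cases m) auto
  then have "\<not> r < of_nat n"
    unfolding m_def by (intro not_less_Least) simp
  with m n that show thesis by (simp add: not_less)
qed

text \<open>A finite \<open>h\<close> has an integer part at every point, so the sets
  \<open>D i\<close> partition the product. On \<open>D i\<close> the density is below
  \<open>i + 1\<close>, so that piece has mass at most \<open>i + 1\<close> times the uniform bound
  of \<open>k\<close>; disjointness makes the pieces mutually singular.\<close>

lemma sigma_finite_kernel_density_of_finite_kernel:
  assumes fin: "finite_kernel X Y k" and h[measurable]: "h \<in> borel_measurable (X \<Otimes>\<^sub>M Y)"
    and h_fin: "\<And>z. z \<in> space (X \<Otimes>\<^sub>M Y) \<Longrightarrow> h z < \<infinity>"
  shows "sigma_finite_kernel X Y (k \<triangleright> h)"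
proof -
  have k: "measure_kernel X Y k"
    using fin unfolding finite_kernel_def by blast
  define D where "D i = {z \<in> space (X \<Otimes>\<^sub>M Y). of_nat i \<le> h z \<and> h z < of_nat (Suc i)}" for i :: nat
  have [measurable]: "D i \<in> sets (X \<Otimes>\<^sub>M Y)" for i
    unfolding D_def by measurable
  have disj: "disjoint_family D"
  proof -
    have "i = j" if "z \<in> D i" "z \<in> D j" for z i j
    proof -
      have "(of_nat i :: ennreal) < of_nat (Suc j)" "(of_nat j :: ennreal) < of_nat (Suc i)"
        using that unfolding D_def by (auto intro: order_le_less_trans)
      then have "i < Suc j" "j < Suc i" by (simp_all only: of_nat_less_iff)
      then show ?thesis by simp
    qed
    then show ?thesis unfolding disjoint_family_on_def by blast
  qed
  have UN_D: "(\<Union>i. D i) = space (X \<Otimes>\<^sub>M Y)"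
    unfolding D_def using ex_nat_level[OF h_fin] by blast
  define ks where "ks i = k \<triangleright> (\<lambda>z. h z * indicator (D i) z)" for i
  have hD[measurable]: "(\<lambda>z. h z * indicator (D i) z) \<in> borel_measurable (X \<Otimes>\<^sub>M Y)" for i
    by measurable
  have ks: "measure_kernel X Y (ks i)" for i
    unfolding ks_def by (rule measure_kernel_kernel_density[OF fin hD])
  have ks_eq: "emeasure (ks i x) B = emeasure ((k \<triangleright> h) x) (Pair x -` D i \<inter> B)"
    if x: "x \<in> space X" and B: "B \<in> sets Y" for i x B
  proof -
    have "Pair x -` D i \<inter> B \<in> sets Y"
      using sets_Pair1[of "D i" X Y x] B by auto
    then show ?thesis
      unfolding ks_def emeasure_kernel_density[OF k x hD B]
      by (subst emeasure_kernel_density[OF k x h])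
         (auto intro!: nn_integral_cong simp: indicator_def)
  qed
  have "finite_kernel X Y (ks i)" for i
  proof -
    define c where "c = (SUP x\<in>space X. emeasure (k x) (space Y))"
    have "emeasure (ks i x) (space Y) \<le> of_nat (Suc i) * c" if x: "x \<in> space X" for x
    proof -
      have "emeasure (ks i x) (space Y) \<le> (\<integral>\<^sup>+ y. of_nat (Suc i) * indicator (space Y) y \<partial>k x)"
        unfolding ks_def emeasure_kernel_density[OF k x hD sets.top]
        by (intro nn_integral_mono) (auto simp: indicator_def D_def)
      also have "\<dots> = of_nat (Suc i) * emeasure (k x) (space Y)"
        using measure_kernel_sets[OF k x] by (intro nn_integral_cmult_indicator) simp
      also have "\<dots> \<le> of_nat (Suc i) * c"
        unfolding c_def using x by (intro mult_left_mono SUP_upper) auto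
      finally show ?thesis .
    qed
    then have "(SUP x\<in>space X. emeasure (ks i x) (space Y)) \<le> of_nat (Suc i) * c"
      by (rule SUP_least)
    also have "\<dots> < \<infinity>"
      using fin of_nat_less_top[of "Suc i"] unfolding finite_kernel_def c_def
      by (simp add: ennreal_mult_less_top del: of_nat_Suc)
    finally show ?thesis
      using ks unfolding finite_kernel_def by blast
  qed
  moreover have "mutually_singular_kernels X Y (ks i) (ks j)" if "i \<noteq> j" for i j
  proof -
    \<comment> \<open>Any measurable \<open>C\<close> containing \<open>D i\<close> supports
      \<open>ks i\<close>. This serves both halves of singularity: \<open>C\<close> is
      \<open>D i\<close> for the first kernel and its complement, which contains \<open>D j\<close>,
      for the second.\<close>
    have null: "emeasure (ks i x) (space Y - {y. (x, y) \<in> C}) = 0"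
      if C: "C \<in> sets (X \<Otimes>\<^sub>M Y)" "D i \<subseteq> C" and x: "x \<in> space X" for i x C
    proof -
      have "{y. (x, y) \<in> C} = Pair x -` C" by auto
      then have "space Y - {y. (x, y) \<in> C} \<in> sets Y"
        using sets_Pair1[OF C(1)] by auto
      moreover have "Pair x -` D i \<inter> (space Y - {y. (x, y) \<in> C}) = {}"
        using C(2) by auto
      ultimately show ?thesis
        by (simp add: ks_eq[OF x])
    qed
    have "space X \<times> space Y - D i \<in> sets (X \<Otimes>\<^sub>M Y)"
      by (metis \<open>\<And>i. D i \<in> sets (X \<Otimes>\<^sub>M Y)\<close> sets.compl_sets space_pair_measure)
    moreover have "D j \<subseteq> space X \<times> space Y - D i"
      using disj \<open>i \<noteq> j\<close> unfolding disjoint_family_on_def D_def space_pair_measure by blast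
    ultimately have "supported_in X Y (ks i) (D i)"
      "supported_in X Y (ks j) (space X \<times> space Y - D i)"
      unfolding supported_in_def using null[of "D i" i] null[of "space X \<times> space Y - D i" j] by simp_all
    then show ?thesis
      unfolding mutually_singular_kernels_def by (intro bexI[of _ "D i"]) auto
  qed
  moreover have "emeasure ((k \<triangleright> h) x) B = (\<Sum>i. emeasure (ks i x) B)"
    if x: "x \<in> space X" and B: "B \<in> sets Y" for x B
  proof -
    have sec: "Pair x -` D i \<inter> B \<in> sets Y" for i
      using sets_Pair1[of "D i" X Y x] B by auto
    have "(\<Sum>i. emeasure (ks i x) B) = (\<Sum>i. emeasure ((k \<triangleright> h) x) (Pair x -` D i \<inter> B))"
      by (simp add: ks_eq[OF x B])
    also have "\<dots> = emeasure ((k \<triangleright> h) x) (\<Union>i. Pair x -` D i \<inter> B)"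
    proof (rule suminf_emeasure)
      show "range (\<lambda>i. Pair x -` D i \<inter> B) \<subseteq> sets ((k \<triangleright> h) x)"
        using measure_kernel_sets[OF k x] sec by (auto simp: kernel_density_def)
      show "disjoint_family (\<lambda>i. Pair x -` D i \<inter> B)"
        using disj unfolding disjoint_family_on_def by blast
    qed
    also have "(\<Union>i. Pair x -` D i \<inter> B) = Pair x -` (\<Union>i. D i) \<inter> B"
      by auto
    also have "\<dots> = B"
      unfolding UN_D using x sets.sets_into_space[OF B] by (auto simp: space_pair_measure)
    finally show ?thesis ..
  qed
  ultimately show ?thesis
    unfolding sigma_finite_kernel_def
    using measure_kernel_kernel_density[OF fin h] by blast
qed

section \<open>Change of density and the three claims\<close>

text \<open>Passing to the finite base kernel \<open>k \<triangleright> g\<close> turns the density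
  \<open>f\<close> into \<open>f / g\<close>, which is still finite, so the slicing result applies.
  Taking \<open>f = 1\<close> gives \<sigma>-finiteness of \<open>k\<close> itself.\<close>

lemma finite_density_imp_sigma_finite_density:
  assumes k: "measure_kernel X Y k"
    and g[measurable]: "g \<in> borel_measurable (X \<Otimes>\<^sub>M Y)"
    and g_pos: "\<And>z. z \<in> space (X \<Otimes>\<^sub>M Y) \<Longrightarrow> 0 < g z \<and> g z < \<infinity>"
    and fin: "finite_kernel X Y (k \<triangleright> g)"
    and f[measurable]: "f \<in> borel_measurable (X \<Otimes>\<^sub>M Y)"
    and f_fin: "\<And>z. z \<in> space (X \<Otimes>\<^sub>M Y) \<Longrightarrow> f z < \<infinity>"
  shows "sigma_finite_kernel X Y (k \<triangleright> f)"
proof -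
  have "sigma_finite_kernel X Y ((k \<triangleright> g) \<triangleright> (\<lambda>z. f z / g z))"
  proof (rule sigma_finite_kernel_density_of_finite_kernel[OF fin])
    show "f z / g z < \<infinity>" if "z \<in> space (X \<Otimes>\<^sub>M Y)" for z
      using f_fin[OF that] g_pos[OF that]
      by (auto simp: less_top[symmetric] ennreal_divide_eq_top_iff)
  qed measurable
  then show ?thesis
    using sigma_finite_kernel_cong[of X, OF kernel_density_kernel_density[OF k _ f g g_pos]] by simp
qed

theorem theorem6:
  fixes X :: "'a measure" and Y :: "'b measure" and \<nu> :: "'a \<Rightarrow> 'b measure"
  assumes "measure_kernel X Y \<nu>"
  shows
    "(\<forall>f \<in> borel_measurable (X \<Otimes>\<^sub>M Y).
        (\<forall>z\<in>space (X \<Otimes>\<^sub>M Y). f z < \<infinity>) \<longrightarrow>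
          (sigma_finite_kernel X Y \<nu> \<longrightarrow> sigma_finite_kernel X Y (\<nu> \<triangleright> f)) \<and>
          (subprob_kernel X Y \<nu> \<longrightarrow> sigma_finite_kernel X Y (\<nu> \<triangleright> f))) \<and>
     (sigma_finite_kernel X Y \<nu> \<longrightarrow>
        (\<exists>\<mu>. \<exists>f \<in> borel_measurable (X \<Otimes>\<^sub>M Y).
           subprob_kernel X Y \<mu> \<and>
           (\<forall>z\<in>space (X \<Otimes>\<^sub>M Y). 0 < f z \<and> f z < \<infinity>) \<and>
           (\<forall>x\<in>space X. \<nu> x = (\<mu> \<triangleright> f) x))) \<and>
     (sigma_finite_kernel X Y \<nu> \<longleftrightarrow>
        (\<exists>g \<in> borel_measurable (X \<Otimes>\<^sub>M Y).
           (\<forall>z\<in>space (X \<Otimes>\<^sub>M Y). 0 < g z \<and> g z < \<infinity>) \<and> subprob_kernel X Y (\<nu> \<triangleright> g))) \<and>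
     (sigma_finite_kernel X Y \<nu> \<longleftrightarrow>
        (\<exists>g \<in> borel_measurable (X \<Otimes>\<^sub>M Y).
           (\<forall>z\<in>space (X \<Otimes>\<^sub>M Y). 0 < g z \<and> g z < \<infinity>) \<and> finite_kernel X Y (\<nu> \<triangleright> g)))"
proof (intro conjI ballI impI)
  note \<nu> = assms
  show "sigma_finite_kernel X Y (\<nu> \<triangleright> f)"
    if "f \<in> borel_measurable (X \<Otimes>\<^sub>M Y)" "\<forall>z\<in>space (X \<Otimes>\<^sub>M Y). f z < \<infinity>" "sigma_finite_kernel X Y \<nu>" for f
    using sigma_finite_kernel_imp_subprob_density[OF that(3)] that(1,2)
      finite_density_imp_sigma_finite_density[OF \<nu> _ _ subprob_kernel_imp_finite_kernel] by metis
  show "sigma_finite_kernel X Y (\<nu> \<triangleright> f)"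
    if "f \<in> borel_measurable (X \<Otimes>\<^sub>M Y)" "\<forall>z\<in>space (X \<Otimes>\<^sub>M Y). f z < \<infinity>" "subprob_kernel X Y \<nu>" for f
    using that sigma_finite_kernel_density_of_finite_kernel[OF subprob_kernel_imp_finite_kernel] by blast
  show "\<exists>\<mu>. \<exists>f\<in>borel_measurable (X \<Otimes>\<^sub>M Y). subprob_kernel X Y \<mu> \<and>
      (\<forall>z\<in>space (X \<Otimes>\<^sub>M Y). 0 < f z \<and> f z < \<infinity>) \<and> (\<forall>x\<in>space X. \<nu> x = (\<mu> \<triangleright> f) x)"
    if sf: "sigma_finite_kernel X Y \<nu>"
  proof -
    obtain g where g[measurable]: "g \<in> borel_measurable (X \<Otimes>\<^sub>M Y)"
      and g_pos: "\<And>z. z \<in> space (X \<Otimes>\<^sub>M Y) \<Longrightarrow> 0 < g z \<and> g z < \<infinity>"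
      and sub: "subprob_kernel X Y (\<nu> \<triangleright> g)"
      using sigma_finite_kernel_imp_subprob_density[OF sf] by blast
    show ?thesis
    \<comment> \<open>The witnesses are \<open>\<nu> \<triangleright> g\<close> for \<mu> and
      \<open>1 / g\<close> for the density, which undoes \<open>g\<close>.\<close>
    proof (intro exI bexI conjI ballI)
      show "subprob_kernel X Y (\<nu> \<triangleright> g)" by fact
      show "(\<lambda>z. 1 / g z) \<in> borel_measurable (X \<Otimes>\<^sub>M Y)" by measurable
      show "0 < 1 / g z" "1 / g z < \<infinity>" if "z \<in> space (X \<Otimes>\<^sub>M Y)" for z
        using g_pos[OF that] by (auto simp: ennreal_zero_less_divide less_top[symmetric] ennreal_divide_eq_top_iff)
      show "\<nu> x = ((\<nu> \<triangleright> g) \<triangleright> (\<lambda>z. 1 / g z)) x" if "x \<in> space X" for x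
        using kernel_density_kernel_density[OF \<nu> that _ g g_pos, of "\<lambda>_. 1"]
        by (simp add: kernel_density_one)
    qed
  qed
  \<comment> \<open>Both equivalences close one cycle: \<sigma>-finiteness gives a subprobability
    density, which is in particular finite, and a finite one gives back \<sigma>-finiteness by the
    case \<open>f = 1\<close>.\<close>
  have fin_imp: "sigma_finite_kernel X Y \<nu>"
    if "g \<in> borel_measurable (X \<Otimes>\<^sub>M Y)" "\<forall>z\<in>space (X \<Otimes>\<^sub>M Y). 0 < g z \<and> g z < \<infinity>"
      "finite_kernel X Y (\<nu> \<triangleright> g)" for g
    using finite_density_imp_sigma_finite_density[OF \<nu> that(1) _ that(3), of "\<lambda>_. 1"] that(2)
    by (simp add: kernel_density_one)
  show "sigma_finite_kernel X Y \<nu> \<longleftrightarrow> (\<exists>g \<in> borel_measurable (X \<Otimes>\<^sub>M Y).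
      (\<forall>z\<in>space (X \<Otimes>\<^sub>M Y). 0 < g z \<and> g z < \<infinity>) \<and> subprob_kernel X Y (\<nu> \<triangleright> g))"
    using fin_imp subprob_kernel_imp_finite_kernel sigma_finite_kernel_imp_subprob_density by metis
  show "sigma_finite_kernel X Y \<nu> \<longleftrightarrow> (\<exists>g \<in> borel_measurable (X \<Otimes>\<^sub>M Y).
      (\<forall>z\<in>space (X \<Otimes>\<^sub>M Y). 0 < g z \<and> g z < \<infinity>) \<and> finite_kernel X Y (\<nu> \<triangleright> g))"
    using fin_imp subprob_kernel_imp_finite_kernel sigma_finite_kernel_imp_subprob_density by metis
qed

end
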